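(* Let $\mathcal{A}=(Q,A,\cdot,\circ)$ be an invertible transducer such that $G=\mathcal{G}(\mathcal{A})$ is not finite, and such that $\mathrm{Stab}_{G}(u^{\omega})=\{1\}$ for all nonempty $u\in A^{*}$. Then the semigroup $\mathcal{S}((\partial\mathcal{A})^{-})$ generated by the enriched dual of $\mathcal{A}$ is torsion-free.
   Context: A transducer $\mathcal{A}=(Q,A,\cdot,\circ)$ consists of a finite set $Q$ of states, a finite alphabet $A$, a transition map $Q\times A\to Q$, $(q,a)\mapsto q\cdot a$, and an output map $Q\times A\to A$, $(q,a)\mapsto q\circ a$. There is an edge $q\xrightarrow{a|b}p$ iff $q\cdot a=p$ and $q\circ a=b$. Each state $q$ acts on $A^{*}$ (and on the set $A^\omega$ of right-infinite words) by $q\circ(a_1a_2\ldots)=(q\circ a_1)\,((q\cdot a_1)\circ(a_2\ldots))$; the semigroup generated by the maps $u\mapsto q\circ u$ ($q\in Q$) on $A^*$ is $\mathcal{S}(\mathcal{A})$. $\mathcal{A}$ is invertible if for each $q$ the map $a\mapsto q\circ a$ is a permutation of $A$; then the states act by automorphisms of the rooted tree $A^*$ and generate a group $\mathcal{G}(\mathcal{A})$, which also acts on $A^\omega$. The dual $\partial\mathcal{A}$ is the transducer with state set $A$ and alphabet $Q$ with edges $a\xrightarrow{p|q}b$ for each edge $p\xrightarrow{a|b}q$ of $\mathcal{A}$. For invertible $\mathcal{A}$, the enriched dual $(\partial\mathcal{A})^{-}$ is the transducer with state set $A$ and alphabet $\tilde Q=Q\sqcup Q^{-1}$ ($Q^{-1}$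 the set of formal inverses) obtained from $\partial\mathcal{A}$ by adding, for each edge $a\xrightarrow{p|q}b$, the edge $b\xrightarrow{p^{-1}|q^{-1}}a$ (this is well defined). An element $s$ of a semigroup has finite order if $\{s^i: i\ge1\}$ is finite; a semigroup (here generated by products of nonempty sequences of generators) is torsion-free if it has no element of finite order. $u^\omega=uuu\cdots$, and $\mathrm{Stab}_G(\xi)=\{g\in G: g(\xi)=\xi\}$. *)

theory Defs
  imports "HOL-Algebra.Elementary_Groups" "HOL-Algebra.Group_Action" "HOL-Library.Stream"
begin

section \<open>Transducers and their actions on words\<close>

text \<open>The state set and the alphabet are the types \<open>'q\<close> and \<open>'a\<close>; finiteness
  is imposed by the type class \<open>finite\<close> where it is needed.\<close>

record ('q, 'a) transducer =
  nxt :: "'q \<Rightarrow> 'a \<Rightarrow> 'q"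
  out :: "'q \<Rightarrow> 'a \<Rightarrow> 'a"

definition edge :: "('q, 'a) transducer \<Rightarrow> 'q \<Rightarrow> 'a \<Rightarrow> 'a \<Rightarrow> 'q \<Rightarrow> bool" where
  "edge T q a b p \<longleftrightarrow> nxt T q a = p \<and> out T q a = b"

primrec act :: "('q, 'a) transducer \<Rightarrow> 'q \<Rightarrow> 'a list \<Rightarrow> 'a list" where
  "act T q [] = []"
| "act T q (a # w) = out T q a # act T (nxt T q a) w"

primcorec act_stream :: "('q, 'a) transducer \<Rightarrow> 'q \<Rightarrow> 'a stream \<Rightarrow> 'a stream" where
  "shd (act_stream T q \<xi>) = out T q (shd \<xi>)"
| "stl (act_stream T q \<xi>) = act_stream T (nxt T q (shd \<xi>)) (stl \<xi>)"

definition invertible_transducer :: "('q, 'a) transducer \<Rightarrow> bool" where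
  "invertible_transducer T \<longleftrightarrow> (\<forall>q. bij (out T q))"


section \<open>The group generated by an invertible transducer\<close>

text \<open>The multiplication is composition of maps. If the transducer is invertible,
  then all maps \<open>act T q\<close> are bijections, so that each of them is indeed a generator.\<close>

definition transducer_group :: "('q, 'a) transducer \<Rightarrow> ('a list \<Rightarrow> 'a list) monoid" where
  "transducer_group T = subgroup_generated (BijGroup UNIV) (range (act T))"

text \<open>The action on infinite words of a length- and prefix-preserving map on finite words.\<close>

definition boundary :: "('a list \<Rightarrow> 'a list) \<Rightarrow> 'a stream \<Rightarrow> 'a stream" where
  "boundary g \<xi> = (THE \<eta>. \<forall>n. stake n \<eta> = g (stake n \<xi>))"


section \<open>The semigroup generated by a transducer\<close>

inductive_set transducer_semigroup :: "('q, 'a) transducer \<Rightarrow> ('a list \<Rightarrow> 'a list) set"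
  for T :: "('q, 'a) transducer" where
  generator: "act T q \<in> transducer_semigroup T"
| product: "\<lbrakk>s \<in> transducer_semigroup T; t \<in> transducer_semigroup T\<rbrakk>
    \<Longrightarrow> s \<circ> t \<in> transducer_semigroup T"

definition finite_order :: "('b \<Rightarrow> 'b) \<Rightarrow> bool" where
  "finite_order s \<longleftrightarrow> finite {s ^^ i | i. i \<ge> 1}"

definition torsion_free :: "('b \<Rightarrow> 'b) set \<Rightarrow> bool" where
  "torsion_free S \<longleftrightarrow> (\<forall>s\<in>S. \<not> finite_order s)"


section \<open>The dual and the enriched dual\<close>

definition dual :: "('q, 'a) transducer \<Rightarrow> ('a, 'q) transducer" where
  "dual T = \<lparr>nxt = (\<lambda>a p. out T p a), out = (\<lambda>a p. nxt T p a)\<rparr>"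

text \<open>The alphabet of the enriched dual is the disjoint sum \<open>'q + 'q\<close>, where \<open>Inl p\<close> is the
  letter \<open>p\<close> and \<open>Inr p\<close> is its formal inverse. The formula for formal inverses is justified
  by \<open>edge_enriched_dual\<close> below.\<close>

definition enriched_dual :: "('q, 'a) transducer \<Rightarrow> ('a, 'q + 'q) transducer" where
  "enriched_dual T =
    \<lparr>nxt = (\<lambda>b x. case x of
        Inl p \<Rightarrow> nxt (dual T) b p
      | Inr p \<Rightarrow> inv_into UNIV (out T p) b),
     out = (\<lambda>b x. case x of
        Inl p \<Rightarrow> Inl (out (dual T) b p)
      | Inr p \<Rightarrow> Inr (nxt T p (inv_into UNIV (out T p) b)))\<rparr>"


section \<open>Basic facts confirming the definitions\<close>

lemma edge_dual: "edge (dual T) a p q b \<longleftrightarrow> edge T p a b q"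
  by (auto simp: edge_def dual_def)

lemma edge_enriched_dual:
  assumes "invertible_transducer T"
  shows "edge (enriched_dual T) a x y b \<longleftrightarrow>
    (\<exists>p q. x = Inl p \<and> y = Inl q \<and> edge (dual T) a p q b) \<or>
    (\<exists>p q. x = Inr p \<and> y = Inr q \<and> edge (dual T) b p q a)"
proof -
  have "bij (out T p)" for p
    using assms by (simp add: invertible_transducer_def)
  then have "inv_into UNIV (out T p) a = b \<longleftrightarrow> out T p b = a" for p
    by (metis bij_inv_eq_iff)
  then show ?thesis
    by (cases x) (force simp: edge_def dual_def enriched_dual_def)+
qed

definition tree_map :: "('a list \<Rightarrow> 'a list) \<Rightarrow> bool" where
  "tree_map g \<longleftrightarrow> (\<forall>w. length (g w) = length w) \<and> (\<forall>n w. take n (g w) = g (take n w))"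

lemma tree_map_act: "tree_map (act T q)"
proof -
  have "length (act T q w) = length w" for q w
    by (induction w arbitrary: q) auto
  moreover have "take n (act T q w) = act T q (take n w)" for n q w
    by (induction w arbitrary: n q) (auto simp: take_Cons split: nat.split)
  ultimately show ?thesis
    by (simp add: tree_map_def)
qed

lemma tree_map_comp: "tree_map g \<Longrightarrow> tree_map h \<Longrightarrow> tree_map (g \<circ> h)"
  by (simp add: tree_map_def)

lemma tree_map_inv:
  assumes "tree_map g" and "bij g"
  shows "tree_map (inv_into UNIV g)"
proof -
  have *: "g (inv_into UNIV g w) = w" for w
    using assms(2) by (simp add: bij_is_surj surj_f_inv_f)
  have "length (inv_into UNIV g w) = length w" for w
    using assms(1) *[of w] unfolding tree_map_def by metis
  moreover have "take n (inv_into UNIV g w) = inv_into UNIV g (take n w)" for n w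
  proof -
    have "g (take n (inv_into UNIV g w)) = take n w"
      using assms(1) *[of w] unfolding tree_map_def by metis
    then show ?thesis
      using assms(2) by (metis bij_inv_eq_iff)
  qed
  ultimately show ?thesis
    by (simp add: tree_map_def)
qed

lemma stake_eqI: "(\<And>n. stake n \<eta> = stake n \<theta>) \<Longrightarrow> \<eta> = \<theta>"
proof -
  assume *: "\<And>n. stake n \<eta> = stake n \<theta>"
  have "\<eta> !! n = \<theta> !! n" for n
    using stake_nth[of n "Suc n" \<eta>] stake_nth[of n "Suc n" \<theta>] *[of "Suc n"]
    by (simp del: stake.simps)
  then have "snth \<eta> = snth \<theta>"
    by (rule ext)
  then show ?thesis
    by (metis stream_smap_nats)
qed

lemma boundary_unique:
  assumes "\<And>n. stake n \<eta> = g (stake n \<xi>)"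
  shows "boundary g \<xi> = \<eta>"
  unfolding boundary_def using assms by (intro the_equality) (auto intro: stake_eqI)

lemma stake_boundary:
  assumes "tree_map g"
  shows "stake n (boundary g \<xi>) = g (stake n \<xi>)"
proof -
  define \<eta> where "\<eta> = smap (\<lambda>n. g (stake (Suc n) \<xi>) ! n) nats"
  have "stake n \<eta> = g (stake n \<xi>)" for n
  proof (rule nth_equalityI)
    show "length (stake n \<eta>) = length (g (stake n \<xi>))"
      using assms by (simp add: tree_map_def)
    fix i assume "i < length (stake n \<eta>)"
    then have "i < n" by simp
    then have "g (stake (Suc i) \<xi>) = take (Suc i) (g (stake n \<xi>))"
      using assms by (simp add: tree_map_def take_stake min_absorb1 del: stake.simps)
    then show "stake n \<eta> ! i = g (stake n \<xi>) ! i"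
      using \<open>i < n\<close> by (simp add: \<eta>_def del: stake.simps)
  qed
  then show ?thesis
    by (metis boundary_unique)
qed

lemma boundary_act: "boundary (act T q) = act_stream T q"
proof
  fix \<xi>
  have "stake n (act_stream T q \<xi>) = act T q (stake n \<xi>)" for n q \<xi>
    by (induction n arbitrary: q \<xi>) auto
  then show "boundary (act T q) \<xi> = act_stream T q \<xi>"
    by (rule boundary_unique)
qed

lemma bij_act:
  assumes "invertible_transducer T"
  shows "bij (act T q)"
proof (rule bijI)
  have b: "bij (out T q)" for q
    using assms by (simp add: invertible_transducer_def)
  show "inj (act T q)"
  proof (rule injI)
    fix v w assume "act T q v = act T q w"
    then show "v = w"
    proof (induction v arbitrary: w q)
      case Nil
      then show ?case by (cases w) auto
    next
      case (Cons a v)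
      then obtain c u where w: "w = c # u" by (cases w) auto
      with Cons.prems have "out T q a = out T q c" by simp
      then have "a = c" using b bij_is_inj injD by metis
      with w Cons show ?case by simp
    qed
  qed
  have "\<exists>v. act T q v = w" for q w
  proof (induction w arbitrary: q)
    case Nil
    then show ?case by (auto intro: exI[of _ "[]"])
  next
    case (Cons a w)
    obtain c where "out T q c = a" using b by (metis bij_pointE)
    moreover obtain v where "act T (nxt T q c) v = w" using Cons by blast
    ultimately show ?case by (intro exI[of _ "c # v"]) simp
  qed
  then show "surj (act T q)" by (metis surjI)
qed

lemma BijGroup_UNIV:
  "carrier (BijGroup UNIV) = {f. bij f}" "\<one>\<^bsub>BijGroup UNIV\<^esub> = id"
  "bij f \<Longrightarrow> bij g \<Longrightarrow> f \<otimes>\<^bsub>BijGroup UNIV\<^esub> g = f \<circ> g"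
  "bij f \<Longrightarrow> inv\<^bsub>BijGroup UNIV\<^esub> f = inv_into UNIV f"
  by (auto simp: BijGroup_def Bij_def compose_def fun_eq_iff)[3]
    (simp add: inv_BijGroup Bij_def restrict_UNIV)

lemma carrier_transducer_group:
  assumes "invertible_transducer T"
  shows "carrier (transducer_group T) = generate (BijGroup UNIV) (range (act T))"
  using bij_act[OF assms]
  by (simp add: transducer_group_def carrier_subgroup_generated BijGroup_UNIV Int_absorb1
      image_subset_iff)

lemma transducer_group_tree_map:
  assumes "invertible_transducer T" and "g \<in> carrier (transducer_group T)"
  shows "bij g \<and> tree_map g"
proof -
  have "g \<in> generate (BijGroup UNIV) (range (act T))"
    using assms carrier_transducer_group by blast
  then show ?thesis
  proof induction
    case one
    then show ?case by (simp add: BijGroup_UNIV(2) tree_map_def bij_id[unfolded id_def])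
  next
    case (incl h)
    then show ?case using bij_act[OF assms(1)] tree_map_act by auto
  next
    case (inv h)
    then have "bij h" "tree_map h"
      using bij_act[OF assms(1)] tree_map_act by auto
    then show ?case
      by (simp add: BijGroup_UNIV bij_imp_bij_inv tree_map_inv)
  next
    case (eng h1 h2)
    then have "h1 \<otimes>\<^bsub>BijGroup UNIV\<^esub> h2 = h1 \<circ> h2"
      by (simp add: BijGroup_UNIV(3))
    with eng show ?case
      using bij_comp[of h2 h1] tree_map_comp[of h1 h2] by metis
  qed
qed

lemma one_transducer_group: "\<one>\<^bsub>transducer_group T\<^esub> = id"
  by (simp add: transducer_group_def BijGroup_UNIV)

lemma mult_transducer_group:
  assumes "invertible_transducer T"
    and "g \<in> carrier (transducer_group T)" "h \<in> carrier (transducer_group T)"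
  shows "g \<otimes>\<^bsub>transducer_group T\<^esub> h = g \<circ> h"
  using transducer_group_tree_map[OF assms(1)] assms(2,3)
  by (simp add: transducer_group_def BijGroup_UNIV)

lemma boundary_id: "boundary id = id"
  by (auto intro!: boundary_unique)

lemma boundary_comp:
  assumes "tree_map g" "tree_map h"
  shows "boundary (g \<circ> h) = boundary g \<circ> boundary h"
  using assms by (auto intro!: boundary_unique simp: stake_boundary)

lemma group_action_boundary:
  assumes "invertible_transducer T"
  shows "group_action (transducer_group T) UNIV boundary"
proof -
  let ?G = "transducer_group T"
  have G: "group ?G"
    unfolding transducer_group_def by (rule group.group_subgroup_generated[OF group_BijGroup])
  have *: "boundary g \<in> carrier (BijGroup UNIV)" if "g \<in> carrier ?G" for g
  proof -
    have g: "bij g" "tree_map g" "tree_map (inv_into UNIV g)"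
      using transducer_group_tree_map[OF assms that] tree_map_inv by auto
    have "inv_into UNIV g \<circ> g = id" "g \<circ> inv_into UNIV g = id"
      using g(1) by (simp_all add: bij_is_inj bij_is_surj flip: surj_iff)
    then have "boundary (inv_into UNIV g) \<circ> boundary g = id"
      "boundary g \<circ> boundary (inv_into UNIV g) = id"
      using g by (simp_all add: boundary_id flip: boundary_comp)
    then have "bij (boundary g)"
      by (rule o_bij)
    then show ?thesis
      by (simp add: BijGroup_UNIV)
  qed
  then have "boundary \<in> hom ?G (BijGroup UNIV)"
    using assms transducer_group_tree_map[OF assms]
    by (intro homI) (auto simp: mult_transducer_group boundary_comp BijGroup_UNIV)
  then show ?thesis
    using G by (simp add: group_action_def group_hom_def group_hom_axioms_def group_BijGroup)
qed

end

theory Submission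
  imports Defs
begin

text \<open>
  The states and inverse states of \<open>T\<close> are the states of one transducer \<open>U\<close>, and
  the enriched dual of \<open>T\<close> is exactly the dual of \<open>U\<close>
  (\<open>enriched_dual_eq_dual\<close>). Hence a product of states of
  the enriched dual, spelled by a word \<open>u\<close> of letters, is the map that sends a word
  \<open>w\<close> of states of \<open>U\<close> to the section of the automorphism \<open>w\<close> at \<open>u\<close>.

  If this map \<open>s\<close> has finite order, then \<open>s\<close> satisfies \<open>s\<^sup>i\<^sup>+\<^sup>p = s\<^sup>i\<close> for some
  \<open>i\<close> and some \<open>p > 0\<close>. Then for every \<open>w\<close> the sections of \<open>w\<close> along \<open>u\<^sup>\<omega>\<close>
  repeat after \<open>i\<close> copies of \<open>u\<close> with period \<open>p\<close>, so \<open>w\<close> maps \<open>u\<^sup>\<omega>\<close> to an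
  eventually periodic word whose preperiod and period have lengths independent of \<open>w\<close>. There
  are only finitely many such words (\<open>finite_images_of_cycle\<close>), and every element of the group
  is represented by some \<open>w\<close> (\<open>transducer_group_word\<close>), so the orbit of
  \<open>u\<^sup>\<omega>\<close> is finite. As its stabilizer is trivial, the orbit-stabilizer theorem makes the group finite, which is a contradiction.
\<close>


section \<open>Sections of words of states\<close>

text \<open>
  Words of states are read from left to right, that is, \<open>fold (act U) w\<close> applies the first
  state of \<open>w\<close> first. In this order the dual transducer, reading \<open>w\<close> from the state \<open>a\<close>,
  carries the successive images of the letter \<open>a\<close> in its state, so that its output is the section
  of \<open>w\<close> at \<open>a\<close>.
\<close>

lemma fold_act_section_letter:
  "fold (act U) w (a # v) = fold (out U) w a # fold (act U) (act (dual U) a w) v"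
  by (induction w arbitrary: a v) (simp_all add: dual_def)

lemma fold_act_stream_section_letter:
  "fold (act_stream U) w (a ## \<xi>) =
     fold (out U) w a ## fold (act_stream U) (act (dual U) a w) \<xi>"
proof (induction w arbitrary: a \<xi>)
  case Nil
  then show ?case by simp
next
  case (Cons q w)
  have "act_stream U q (a ## \<xi>) = out U q a ## act_stream U (nxt U q a) \<xi>"
    by (simp add: stream.expand)
  with Cons show ?case
    by (simp add: dual_def)
qed

lemma length_fold_act: "length (fold (act U) w v) = length v"
  using tree_map_act[of U] by (induction w arbitrary: v) (simp_all add: tree_map_def)

lemma fold_act_stream_section:
  "fold (act_stream U) w (u @- \<xi>) =
     fold (act U) w u @- fold (act_stream U) (fold (act (dual U)) u w) \<xi>"
proof (induction u arbitrary: w)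
  case Nil
  have "fold (act U) w [] = []"
    using length_fold_act[of U w "[]"] by simp
  then show ?case by simp
next
  case (Cons a u)
  then show ?case
    by (simp add: fold_act_section_letter fold_act_stream_section_letter)
qed

lemma boundary_fold_act: "boundary (fold (act U) w) = fold (act_stream U) w"
proof
  fix \<xi>
  have "stake n (fold (act_stream U) w \<xi>) = fold (act U) w (stake n \<xi>)" for n
    using fold_act_stream_section[of U w "stake n \<xi>" "sdrop n \<xi>"]
    by (simp add: stake_sdrop stake_shift length_fold_act)
  then show "boundary (fold (act U) w) \<xi> = fold (act_stream U) w \<xi>"
    by (rule boundary_unique)
qed


section \<open>Periodic words\<close>

lemma eq_cycleI:
  assumes "\<xi> = v @- \<xi>" and "v \<noteq> []"
  shows "\<xi> = cycle v"
proof -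
  have "\<xi> !! n = cycle v !! n" for n
  proof (induction n rule: less_induct)
    case (less n)
    show ?case
    proof (cases "n < length v")
      case True
      then show ?thesis
        by (metis assms cycle_decomp shift_snth_less)
    next
      case False
      moreover have "length v > 0"
        using assms(2) by simp
      ultimately have "n - length v < n"
        by linarith
      then have "\<xi> !! (n - length v) = cycle v !! (n - length v)"
        by (rule less)
      with False show ?thesis
        by (metis assms cycle_decomp not_less shift_snth_ge)
    qed
  qed
  then have "snth \<xi> = snth (cycle v)"
    by (rule ext)
  then show ?thesis
    by (metis stream_smap_nats)
qed

lemma cycle_unroll:
  assumes "u \<noteq> []"
  shows "concat (replicate n u) @- cycle u = cycle u"
  using cycle_decomp[OF assms] by (induction n) simp_all

text \<open>
  If \<open>v\<close> is a period of \<open>\<xi>\<close> and the word \<open>w\<close> is its own section at \<open>v\<close>, then \<open>w\<close>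
  meets each further copy of \<open>v\<close> in the same way, so the length of \<open>v\<close> is also a period of
  the image.
\<close>

lemma fold_act_stream_periodic:
  assumes "\<xi> = v @- \<xi>" and "v \<noteq> []" and "fold (act (dual U)) v w = w"
  shows "fold (act_stream U) w \<xi> = cycle (fold (act U) w v)"
proof (rule eq_cycleI)
  show "fold (act_stream U) w \<xi> = fold (act U) w v @- fold (act_stream U) w \<xi>"
    using fold_act_stream_section[of U w v \<xi>] assms by simp
  show "fold (act U) w v \<noteq> []"
    using assms(2) length_fold_act[of U w v] by force
qed


section \<open>Elements of finite order in the semigroup of a dual\<close>

lemma transducer_semigroup_word:
  assumes "s \<in> transducer_semigroup T"
  shows "\<exists>u. u \<noteq> [] \<and> s = fold (act T) u"
  using assms
proof induction
  case (generator q)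
  have "act T q = fold (act T) [q]" by simp
  then show ?case by blast
next
  case (product s t)
  then obtain u v where "u \<noteq> []" "s = fold (act T) u" "t = fold (act T) v"
    by blast
  then have "v @ u \<noteq> [] \<and> s \<circ> t = fold (act T) (v @ u)"
    by simp
  then show ?case by blast
qed

lemma fold_concat_replicate: "fold f (concat (replicate n u)) = fold f u ^^ n"
  by (induction n) (simp_all add: funpow_swap1 fun_eq_iff)

lemma finite_order_eventually_periodic:
  assumes "finite_order s"
  shows "\<exists>i p. p > 0 \<and> s ^^ (p + i) = s ^^ i"
proof -
  have "{s ^^ i | i. i \<ge> 1} = (\<lambda>i. s ^^ i) ` {1..}"
    by auto
  then have "\<not> inj_on (\<lambda>i. s ^^ i) {1..}"
    using assms finite_imageD[of "\<lambda>i. s ^^ i" "{1..}"] infinite_Ici[of "1::nat"]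
    by (auto simp: finite_order_def)
  then obtain i j where "s ^^ i = s ^^ j" "i < j"
    unfolding inj_on_def by (metis nat_neq_iff)
  then have "j - i > 0 \<and> s ^^ ((j - i) + i) = s ^^ i"
    by simp
  then show ?thesis by blast
qed

text \<open>
  The exponents \<open>i\<close> and \<open>p\<close> in \<open>s\<^sup>p\<^sup>+\<^sup>i = s\<^sup>i\<close> come from the order of the map \<open>s\<close>
  and thus serve all words \<open>w\<close> at once. Over finitely many states the sections of a single \<open>w\<close>
  recur anyway, since they all have the length of \<open>w\<close>, but their periods may grow with
  \<open>w\<close>; the uniformity is what makes the set of images finite.
\<close>

lemma finite_images_of_cycle:
  fixes U :: "('q, 'a::finite) transducer"
  assumes "u \<noteq> []" and "finite_order (fold (act (dual U)) u)"
  shows "finite (range (\<lambda>w. fold (act_stream U) w (cycle u)))"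
proof -
  let ?s = "fold (act (dual U)) u"
  obtain i p where p: "p > 0" "?s ^^ (p + i) = ?s ^^ i"
    using finite_order_eventually_periodic[OF assms(2)] by blast
  let ?x = "concat (replicate i u)" and ?v = "concat (replicate p u)"
  let ?X = "{x::'a list. length x = length ?x}" and ?V = "{v::'a list. length v = length ?v}"
  have "fold (act_stream U) w (cycle u) \<in> (\<lambda>(x, v). x @- cycle v) ` (?X \<times> ?V)" for w
  proof -
    let ?y = "fold (act (dual U)) ?x w"
    \<comment> \<open>After \<open>i\<close> copies of \<open>u\<close> the section is fixed by \<open>p\<close> further copies.\<close>
    have "fold (act (dual U)) ?v ?y = ?y"
      using p(2) by (simp only: fold_concat_replicate funpow_add o_def fun_eq_iff)
    moreover have "?v \<noteq> []"
      using assms(1) p(1) by simp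
    ultimately have "fold (act_stream U) ?y (cycle u) = cycle (fold (act U) ?y ?v)"
      using cycle_unroll[OF assms(1), of p] by (intro fold_act_stream_periodic) simp_all
    then have "fold (act_stream U) w (cycle u) =
        fold (act U) w ?x @- cycle (fold (act U) ?y ?v)"
      using fold_act_stream_section[of U w ?x "cycle u"] cycle_unroll[OF assms(1), of i] by simp
    then show ?thesis
      by (intro image_eqI[of _ _ "(fold (act U) w ?x, fold (act U) ?y ?v)"])
        (simp_all add: length_fold_act)
  qed
  moreover have "finite (?X \<times> ?V)"
    using finite_lists_length_eq[of "UNIV :: 'a set"] by simp
  ultimately show ?thesis
    by (meson finite_imageI finite_subset image_subsetI)
qed


section \<open>Adjoining the inverse states\<close>

definition with_inverse_states :: "('q, 'a) transducer \<Rightarrow> ('q + 'q, 'a) transducer" where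
  "with_inverse_states T =
    \<lparr>nxt = (\<lambda>x a. case x of
        Inl p \<Rightarrow> Inl (nxt T p a)
      | Inr p \<Rightarrow> Inr (nxt T p (inv_into UNIV (out T p) a))),
     out = (\<lambda>x a. case x of
        Inl p \<Rightarrow> out T p a
      | Inr p \<Rightarrow> inv_into UNIV (out T p) a)\<rparr>"

lemma enriched_dual_eq_dual: "enriched_dual T = dual (with_inverse_states T)"
  by (auto simp: enriched_dual_def dual_def with_inverse_states_def fun_eq_iff split: sum.split)

lemma act_with_inverse_states_Inl: "act (with_inverse_states T) (Inl p) = act T p"
proof
  show "act (with_inverse_states T) (Inl p) v = act T p v" for v
    by (induction v arbitrary: p) (simp_all add: with_inverse_states_def)
qed

lemma act_with_inverse_states_Inr:
  assumes "invertible_transducer T"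
  shows "act (with_inverse_states T) (Inr p) = inv_into UNIV (act T p)"
proof -
  have "inj (out T q)" for q
    using assms by (simp add: invertible_transducer_def bij_is_inj)
  then have "act (with_inverse_states T) (Inr p) (act T p v) = v" for v
    by (induction v arbitrary: p) (simp_all add: with_inverse_states_def)
  then show ?thesis
    using bij_act[OF assms, of p] by (metis bij_inv_eq_iff ext)
qed

lemma transducer_group_word:
  assumes "invertible_transducer T" and "g \<in> carrier (transducer_group T)"
  shows "\<exists>w. g = fold (act (with_inverse_states T)) w"
proof -
  let ?U = "with_inverse_states T"
  have letter: "act ?U x = fold (act ?U) [x]" for x
    by simp
  have "g \<in> generate (BijGroup UNIV) (range (act T))"
    using assms carrier_transducer_group by blast
  then show ?thesis
  proof induction
    case one
    have "\<one>\<^bsub>BijGroup UNIV\<^esub> = fold (act ?U) []"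
      by (simp add: BijGroup_UNIV(2) fun_eq_iff)
    then show ?case by blast
  next
    case (incl h)
    then show ?case
      by (metis imageE act_with_inverse_states_Inl letter)
  next
    case (inv h)
    then obtain p where "h = act T p" by blast
    then have "inv\<^bsub>BijGroup UNIV\<^esub> h = act ?U (Inr p)"
      using bij_act[OF assms(1)] by (simp add: BijGroup_UNIV act_with_inverse_states_Inr[OF assms(1)])
    then show ?case
      using letter by metis
  next
    case (eng h1 h2)
    then obtain w1 w2 where w: "h1 = fold (act ?U) w1" "h2 = fold (act ?U) w2"
      by blast
    have "bij h1" "bij h2"
      using eng.hyps transducer_group_tree_map[OF assms(1)] carrier_transducer_group[OF assms(1)]
      by blast+
    then have "h1 \<otimes>\<^bsub>BijGroup UNIV\<^esub> h2 = fold (act ?U) (w2 @ w1)"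
      using w by (simp add: BijGroup_UNIV(3))
    then show ?case by blast
  qed
qed


section \<open>Torsion-freeness\<close>

theorem corollary5:
  fixes T :: "('q::finite, 'a::finite) transducer"
  assumes "invertible_transducer T"
    and "infinite (carrier (transducer_group T))"
    and "\<forall>u. u \<noteq> [] \<longrightarrow>
      stabilizer (transducer_group T) boundary (cycle u) = {\<one>\<^bsub>transducer_group T\<^esub>}"
  shows "torsion_free (transducer_semigroup (enriched_dual T))"
  unfolding torsion_free_def
proof (intro ballI notI)
  let ?G = "transducer_group T" and ?U = "with_inverse_states T"
  fix s assume "s \<in> transducer_semigroup (enriched_dual T)" and fin: "finite_order s"
  then obtain u where u: "u \<noteq> []" "s = fold (act (dual ?U)) u"
    using transducer_semigroup_word by (metis enriched_dual_eq_dual)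
  interpret group_action ?G UNIV boundary
    by (rule group_action_boundary[OF assms(1)])
  have "orbit ?G boundary (cycle u) \<subseteq> range (\<lambda>w. fold (act_stream ?U) w (cycle u))"
  proof
    fix \<eta> assume "\<eta> \<in> orbit ?G boundary (cycle u)"
    then obtain g where "g \<in> carrier ?G" "\<eta> = boundary g (cycle u)"
      by (auto simp: orbit_def)
    then show "\<eta> \<in> range (\<lambda>w. fold (act_stream ?U) w (cycle u))"
      using transducer_group_word[OF assms(1)] boundary_fold_act by (metis rangeI)
  qed
  then have "finite (orbit ?G boundary (cycle u))"
    using finite_images_of_cycle[of u ?U] u fin finite_subset by metis
  moreover have "cycle u \<in> orbit ?G boundary (cycle u)"
    by (simp add: orbit_refl)
  moreover have "card (orbit ?G boundary (cycle u)) * card {\<one>\<^bsub>?G\<^esub>} = order ?G"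
    using orbit_stabilizer_theorem[of "cycle u"] assms(3) u(1) by simp
  \<comment> \<open>The order of an infinite group is \<open>0\<close>, whereas the orbit is finite and nonempty.\<close>
  ultimately show False
    using assms(2) by (auto simp: order_def)
qed

end
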